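(* Let $\mathcal C$ be a complete and cocomplete category, let $\rho$ be a height-difference function on a poset $P$, and let $f:Q\to P$ be an order-preserving map of posets. Then for any $M,N\in\mathrm{Fun}(P,\mathcal C)$, $$d_{f^*\rho}(f^*M,f^*N)\le d_\rho(M,N).$$
   Context: A poset $P$ is regarded as a category (a unique morphism $a\to b$ iff $a\le b$), and $\mathrm{Fun}(P,\mathcal C)$ is the category of functors $P\to\mathcal C$ and natural transformations. All infima of empty sets are $\infty$. A height-difference function on $P$ is a function $\rho:\{(a,b)\in P\times P: a\le b\}\to[0,\infty]$ with $\rho(a,a)=0$ for all $a$ and $\rho(a,c)\ge\rho(a,b)+\rho(b,c)$ whenever $a\le b\le c$. For an order-preserving $f:Q\to P$, $f^*\rho$ is the height-difference function on $Q$ given by $(f^*\rho)(q,q')=\rho(f(q),f(q'))$ for $q\le q'$, and $f^*:\mathrm{Fun}(P,\mathcal C)\to\mathrm{Fun}(Q,\mathcal C)$ is precomposition with $f$. For $a\in P$ and real $r\ge 0$ put $a^{\downarrow_r}=\{x\in P: x\le a,\ \rho(x,a)\ge r\}$ and $a^{\uparrow_r}=\{x\in P: x\ge a,\ \rho(a,x)\ge r\}$ (full subposets). Endofunctors $\mathsf L_r=\mathsf L_r^\rho$ and $\mathsf R_r=\mathsf R_r^\rho$ of $\mathrm{Fun}(P,\mathcal C)$: $(\mathsf L_rM)(a)=\operatorname{colim} M|_{a^{\downarrow_r}}$ and $(\mathsf R_rM)(a)=\lim M|_{a^{\uparrow_r}}$, with structure morphisms for $a\le b$ (using $a^{\downarrow_r}\subseteq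 b^{\downarrow_r}$, $b^{\uparrow_r}\subseteq a^{\uparrow_r}$) and the action on morphisms induced by the universal properties. Write $\alpha_{a,M}(x):M(x)\to(\mathsf L_rM)(a)$ ($x\in a^{\downarrow_r}$) and $\beta_{a,M}(y):(\mathsf R_rM)(a)\to M(y)$ ($y\in a^{\uparrow_r}$) for the canonical maps. The functor $\mathsf L_r$ is left adjoint to $\mathsf R_r$; for $p:M\to\mathsf R_rN$, its adjoint $p^\sharp:\mathsf L_rM\to N$ is the unique morphism with $p^\sharp(a)\circ\alpha_{a,M}(x)=\beta_{x,N}(a)\circ p(x)$ for all $a\in P$, $x\in a^{\downarrow_r}$. Let $\eta^{\mathsf L}_{r,M}:\mathsf L_rM\to M$ and $\eta^{\mathsf R}_{r,M}:M\to\mathsf R_rM$ be induced by the structure maps $M(x\le a)$, $x\in a^{\downarrow_r}$, respectively $M(a\le y)$, $y\in a^{\uparrow_r}$, and set $e_{r,M}=\eta^{\mathsf R}_{r,M}\circ\eta^{\mathsf L}_{r,M}:\mathsf L_rM\to\mathsf R_rM$. $M,N\in\mathrm{Fun}(P,\mathcal C)$ are $r$-height-interleaved with respect to $\rho$ if there are $p:M\to\mathsf R_rN$ and $q:N\to\mathsf R_rM$ with $e_{r,M}=q\circ p^\sharp$ and $e_{r,N}=p\circ q^\sharp$. The height-interleaving distance is $d_\rho(M,N)=\inf\{r\ge0: M,N \text{ are } r\text{-height-interleaved w.r.t. }\rho\}\in[0,\infty]$. *)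

theory Defs
  imports "HOL-Library.FuncSet" "HOL-Library.Extended_Nonnegative_Real"
begin

section \<open>Categories, functors, natural transformations\<close>

record ('o, 'm) cat =
  Obj :: "'o set"
  Arr :: "'m set"
  Dom :: "'m \<Rightarrow> 'o"
  Cod :: "'m \<Rightarrow> 'o"
  Ident :: "'o \<Rightarrow> 'm"
  Comp :: "'m \<Rightarrow> 'm \<Rightarrow> 'm"  \<comment> \<open>\<open>Comp C g f\<close> is \<open>g \<circ> f\<close>, meaningful when \<open>Cod C f = Dom C g\<close>\<close>

definition hom :: "('o, 'm) cat \<Rightarrow> 'o \<Rightarrow> 'o \<Rightarrow> 'm set" where
  "hom C a b = {f \<in> Arr C. Dom C f = a \<and> Cod C f = b}"

locale category =
  fixes C :: "('o, 'm) cat"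
  assumes Dom_in_Obj: "f \<in> Arr C \<Longrightarrow> Dom C f \<in> Obj C"
    and Cod_in_Obj: "f \<in> Arr C \<Longrightarrow> Cod C f \<in> Obj C"
    and Ident_in_hom: "a \<in> Obj C \<Longrightarrow> Ident C a \<in> hom C a a"
    and Comp_in_hom: "f \<in> hom C a b \<Longrightarrow> g \<in> hom C b c \<Longrightarrow> Comp C g f \<in> hom C a c"
    and Comp_Ident_left: "f \<in> hom C a b \<Longrightarrow> Comp C (Ident C b) f = f"
    and Comp_Ident_right: "f \<in> hom C a b \<Longrightarrow> Comp C f (Ident C a) = f"
    and Comp_assoc: "f \<in> hom C a b \<Longrightarrow> g \<in> hom C b c \<Longrightarrow> h \<in> hom C c d
      \<Longrightarrow> Comp C h (Comp C g f) = Comp C (Comp C h g) f"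

record ('i, 'j, 'o, 'm) func =
  Omap :: "'i \<Rightarrow> 'o"
  Amap :: "'j \<Rightarrow> 'm"

definition is_functor ::
  "('i, 'j) cat \<Rightarrow> ('o, 'm) cat \<Rightarrow> ('i, 'j, 'o, 'm) func \<Rightarrow> bool" where
  "is_functor J C F \<longleftrightarrow>
     (\<forall>j\<in>Obj J. Omap F j \<in> Obj C) \<and>
     (\<forall>u\<in>Arr J. Amap F u \<in> hom C (Omap F (Dom J u)) (Omap F (Cod J u))) \<and>
     (\<forall>j\<in>Obj J. Amap F (Ident J j) = Ident C (Omap F j)) \<and>
     (\<forall>u\<in>Arr J. \<forall>v\<in>Arr J. Cod J u = Dom J v \<longrightarrow>
        Amap F (Comp J v u) = Comp C (Amap F v) (Amap F u))"

text \<open>Families of components are required to be extensional, so that equality of natural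
  transformations is equality of their components at the objects of the source category.\<close>

definition is_nat_trans ::
  "('i, 'j) cat \<Rightarrow> ('o, 'm) cat \<Rightarrow> ('i, 'j, 'o, 'm) func \<Rightarrow> ('i, 'j, 'o, 'm) func \<Rightarrow> ('i \<Rightarrow> 'm) \<Rightarrow> bool"
  where
  "is_nat_trans J C F G t \<longleftrightarrow>
     t \<in> extensional (Obj J) \<and>
     (\<forall>j\<in>Obj J. t j \<in> hom C (Omap F j) (Omap G j)) \<and>
     (\<forall>u\<in>Arr J. Comp C (t (Cod J u)) (Amap F u) = Comp C (Amap G u) (t (Dom J u)))"

definition nt_comp ::
  "('i, 'j) cat \<Rightarrow> ('o, 'm) cat \<Rightarrow> ('i \<Rightarrow> 'm) \<Rightarrow> ('i \<Rightarrow> 'm) \<Rightarrow> ('i \<Rightarrow> 'm)" where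
  "nt_comp J C t s = (\<lambda>j\<in>Obj J. Comp C (t j) (s j))"


section \<open>Limits and colimits\<close>

definition is_cone ::
  "('i, 'j) cat \<Rightarrow> ('o, 'm) cat \<Rightarrow> ('i, 'j, 'o, 'm) func \<Rightarrow> 'o \<Rightarrow> ('i \<Rightarrow> 'm) \<Rightarrow> bool" where
  "is_cone J C F c l \<longleftrightarrow>
     c \<in> Obj C \<and>
     (\<forall>j\<in>Obj J. l j \<in> hom C c (Omap F j)) \<and>
     (\<forall>u\<in>Arr J. Comp C (Amap F u) (l (Dom J u)) = l (Cod J u))"

definition is_limit ::
  "('i, 'j) cat \<Rightarrow> ('o, 'm) cat \<Rightarrow> ('i, 'j, 'o, 'm) func \<Rightarrow> 'o \<Rightarrow> ('i \<Rightarrow> 'm) \<Rightarrow> bool" where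
  "is_limit J C F c l \<longleftrightarrow>
     is_cone J C F c l \<and>
     (\<forall>d k. is_cone J C F d k \<longrightarrow> (\<exists>!h. h \<in> hom C d c \<and> (\<forall>j\<in>Obj J. Comp C (l j) h = k j)))"

definition is_cocone ::
  "('i, 'j) cat \<Rightarrow> ('o, 'm) cat \<Rightarrow> ('i, 'j, 'o, 'm) func \<Rightarrow> 'o \<Rightarrow> ('i \<Rightarrow> 'm) \<Rightarrow> bool" where
  "is_cocone J C F c l \<longleftrightarrow>
     c \<in> Obj C \<and>
     (\<forall>j\<in>Obj J. l j \<in> hom C (Omap F j) c) \<and>
     (\<forall>u\<in>Arr J. Comp C (l (Cod J u)) (Amap F u) = l (Dom J u))"

definition is_colimit ::
  "('i, 'j) cat \<Rightarrow> ('o, 'm) cat \<Rightarrow> ('i, 'j, 'o, 'm) func \<Rightarrow> 'o \<Rightarrow> ('i \<Rightarrow> 'm) \<Rightarrow> bool" where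
  "is_colimit J C F c l \<longleftrightarrow>
     is_cocone J C F c l \<and>
     (\<forall>d k. is_cocone J C F d k \<longrightarrow> (\<exists>!h. h \<in> hom C c d \<and> (\<forall>j\<in>Obj J. Comp C h (l j) = k j)))"

text \<open>(Co)completeness refers to small diagrams, and here the type \<open>'u\<close> plays the role of the
  universe: the small categories are those with objects in \<open>'u\<close> and arrows in \<open>'u \<times> 'u\<close>, the small
  posets those with elements in \<open>'u\<close>. For infinite \<open>'u\<close>, up to isomorphism these are all categories
  and posets of cardinality at most that of \<open>'u\<close>. The types of objects and arrows of \<open>C\<close> are
  unrelated to \<open>'u\<close>, so \<open>C\<close> may be large.\<close>

definition complete_category :: "'u itself \<Rightarrow> ('o, 'm) cat \<Rightarrow> bool" where
  "complete_category U C \<longleftrightarrow>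
     (\<forall>(J :: ('u, 'u \<times> 'u) cat) F. category J \<and> is_functor J C F \<longrightarrow> (\<exists>c l. is_limit J C F c l))"

definition cocomplete_category :: "'u itself \<Rightarrow> ('o, 'm) cat \<Rightarrow> bool" where
  "cocomplete_category U C \<longleftrightarrow>
     (\<forall>(J :: ('u, 'u \<times> 'u) cat) F. category J \<and> is_functor J C F \<longrightarrow> (\<exists>c l. is_colimit J C F c l))"

text \<open>A chosen (co)limit together with its canonical maps.\<close>

definition lim_cone ::
  "('i, 'j) cat \<Rightarrow> ('o, 'm) cat \<Rightarrow> ('i, 'j, 'o, 'm) func \<Rightarrow> 'o \<times> ('i \<Rightarrow> 'm)" where
  "lim_cone J C F = (SOME (c, l). is_limit J C F c l)"

definition colim_cocone ::
  "('i, 'j) cat \<Rightarrow> ('o, 'm) cat \<Rightarrow> ('i, 'j, 'o, 'm) func \<Rightarrow> 'o \<times> ('i \<Rightarrow> 'm)" where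
  "colim_cocone J C F = (SOME (c, l). is_colimit J C F c l)"

text \<open>The morphism into the limit, respectively out of the colimit, induced by a (co)cone
  with vertex \<open>d\<close> and legs \<open>k\<close>.\<close>

definition into_lim ::
  "('i, 'j) cat \<Rightarrow> ('o, 'm) cat \<Rightarrow> ('i, 'j, 'o, 'm) func \<Rightarrow> 'o \<Rightarrow> ('i \<Rightarrow> 'm) \<Rightarrow> 'm" where
  "into_lim J C F d k = (THE h. h \<in> hom C d (fst (lim_cone J C F)) \<and>
     (\<forall>j\<in>Obj J. Comp C (snd (lim_cone J C F) j) h = k j))"

definition from_colim ::
  "('i, 'j) cat \<Rightarrow> ('o, 'm) cat \<Rightarrow> ('i, 'j, 'o, 'm) func \<Rightarrow> 'o \<Rightarrow> ('i \<Rightarrow> 'm) \<Rightarrow> 'm" where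
  "from_colim J C F d k = (THE h. h \<in> hom C (fst (colim_cocone J C F)) d \<and>
     (\<forall>j\<in>Obj J. Comp C h (snd (colim_cocone J C F) j) = k j))"


section \<open>Posets\<close>

text \<open>A poset is its order relation \<open>P\<close> with \<open>Partial_order P\<close>: the underlying set is \<open>Field P\<close>, and
  \<open>a \<le> b\<close> means \<open>(a, b) \<in> P\<close>. The pair \<open>(a, b)\<close> is also the unique morphism from \<open>a\<close> to \<open>b\<close>.
  The full subposet on \<open>S\<close> is \<open>Restr P S\<close>.\<close>

definition poset_cat :: "'u rel \<Rightarrow> ('u, 'u \<times> 'u) cat" where
  "poset_cat P = \<lparr> Obj = Field P, Arr = P, Dom = fst, Cod = snd,
     Ident = (\<lambda>a. (a, a)), Comp = (\<lambda>g f. (fst f, snd g)) \<rparr>"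

lemma category_poset_cat:
  assumes "Partial_order P"
  shows "category (poset_cat P)"
  using partial_order_onD[OF assms]
  by unfold_locales
    (auto simp: poset_cat_def hom_def Field_def refl_on_def dest: transD)

definition order_preserving :: "'u rel \<Rightarrow> 'u rel \<Rightarrow> ('u \<Rightarrow> 'u) \<Rightarrow> bool" where
  "order_preserving Q P f \<longleftrightarrow> f \<in> Field Q \<rightarrow> Field P \<and> (\<forall>(x, y)\<in>Q. (f x, f y) \<in> P)"

type_synonym ('u, 'o, 'm) pfunc = "('u, 'u \<times> 'u, 'o, 'm) func"

definition pullback :: "('u \<Rightarrow> 'u) \<Rightarrow> ('u, 'o, 'm) pfunc \<Rightarrow> ('u, 'o, 'm) pfunc" where
  "pullback f M = \<lparr> Omap = Omap M \<circ> f, Amap = Amap M \<circ> map_prod f f \<rparr>"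

text \<open>Only the values \<open>\<rho> a b\<close> with \<open>(a, b) \<in> P\<close> are relevant.\<close>

definition height_difference :: "'u rel \<Rightarrow> ('u \<Rightarrow> 'u \<Rightarrow> ennreal) \<Rightarrow> bool" where
  "height_difference P \<rho> \<longleftrightarrow>
     (\<forall>a\<in>Field P. \<rho> a a = 0) \<and>
     (\<forall>a b c. (a, b) \<in> P \<and> (b, c) \<in> P \<longrightarrow> \<rho> a c \<ge> \<rho> a b + \<rho> b c)"

definition pullback_height :: "('u \<Rightarrow> 'u) \<Rightarrow> ('u \<Rightarrow> 'u \<Rightarrow> ennreal) \<Rightarrow> ('u \<Rightarrow> 'u \<Rightarrow> ennreal)" where
  "pullback_height f \<rho> = (\<lambda>q q'. \<rho> (f q) (f q'))"

definition down :: "'u rel \<Rightarrow> ('u \<Rightarrow> 'u \<Rightarrow> ennreal) \<Rightarrow> real \<Rightarrow> 'u \<Rightarrow> 'u set" where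
  "down P \<rho> r a = {x \<in> Field P. (x, a) \<in> P \<and> \<rho> x a \<ge> ennreal r}"

definition up :: "'u rel \<Rightarrow> ('u \<Rightarrow> 'u \<Rightarrow> ennreal) \<Rightarrow> real \<Rightarrow> 'u \<Rightarrow> 'u set" where
  "up P \<rho> r a = {x \<in> Field P. (a, x) \<in> P \<and> \<rho> a x \<ge> ennreal r}"

abbreviation down_cat :: "'u rel \<Rightarrow> ('u \<Rightarrow> 'u \<Rightarrow> ennreal) \<Rightarrow> real \<Rightarrow> 'u \<Rightarrow> ('u, 'u \<times> 'u) cat" where
  "down_cat P \<rho> r a \<equiv> poset_cat (Restr P (down P \<rho> r a))"

abbreviation up_cat :: "'u rel \<Rightarrow> ('u \<Rightarrow> 'u \<Rightarrow> ennreal) \<Rightarrow> real \<Rightarrow> 'u \<Rightarrow> ('u, 'u \<times> 'u) cat" where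
  "up_cat P \<rho> r a \<equiv> poset_cat (Restr P (up P \<rho> r a))"


section \<open>The functors L and R\<close>

context
  fixes C :: "('o, 'm) cat" and P :: "'u rel" and \<rho> :: "'u \<Rightarrow> 'u \<Rightarrow> ennreal" and r :: real
begin

text \<open>Functors are not extensional, so \<open>M\<close> itself also represents its restrictions to full
  subposets of \<open>P\<close>.\<close>

definition alpha :: "('u, 'o, 'm) pfunc \<Rightarrow> 'u \<Rightarrow> 'u \<Rightarrow> 'm" where
  "alpha M a = snd (colim_cocone (down_cat P \<rho> r a) C M)"

definition beta :: "('u, 'o, 'm) pfunc \<Rightarrow> 'u \<Rightarrow> 'u \<Rightarrow> 'm" where
  "beta M a = snd (lim_cone (up_cat P \<rho> r a) C M)"

definition L_obj :: "('u, 'o, 'm) pfunc \<Rightarrow> 'u \<Rightarrow> 'o" where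
  "L_obj M a = fst (colim_cocone (down_cat P \<rho> r a) C M)"

definition R_obj :: "('u, 'o, 'm) pfunc \<Rightarrow> 'u \<Rightarrow> 'o" where
  "R_obj M a = fst (lim_cone (up_cat P \<rho> r a) C M)"

definition L_fun :: "('u, 'o, 'm) pfunc \<Rightarrow> ('u, 'o, 'm) pfunc" where
  "L_fun M = \<lparr> Omap = L_obj M,
     Amap = (\<lambda>(a, b). from_colim (down_cat P \<rho> r a) C M (L_obj M b) (alpha M b)) \<rparr>"

definition R_fun :: "('u, 'o, 'm) pfunc \<Rightarrow> ('u, 'o, 'm) pfunc" where
  "R_fun M = \<lparr> Omap = R_obj M,
     Amap = (\<lambda>(a, b). into_lim (up_cat P \<rho> r b) C M (R_obj M a) (beta M a)) \<rparr>"

text \<open>The adjoint \<open>L M \<rightarrow> N\<close> of \<open>p : M \<rightarrow> R N\<close>.\<close>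

definition sharp ::
  "('u, 'o, 'm) pfunc \<Rightarrow> ('u, 'o, 'm) pfunc \<Rightarrow> ('u \<Rightarrow> 'm) \<Rightarrow> ('u \<Rightarrow> 'm)" where
  "sharp M N p = (THE s. is_nat_trans (poset_cat P) C (L_fun M) N s \<and>
     (\<forall>a\<in>Field P. \<forall>x\<in>down P \<rho> r a. Comp C (s a) (alpha M a x) = Comp C (beta N x a) (p x)))"

definition eta_L :: "('u, 'o, 'm) pfunc \<Rightarrow> 'u \<Rightarrow> 'm" where
  "eta_L M = (\<lambda>a\<in>Field P. from_colim (down_cat P \<rho> r a) C M (Omap M a) (\<lambda>x. Amap M (x, a)))"

definition eta_R :: "('u, 'o, 'm) pfunc \<Rightarrow> 'u \<Rightarrow> 'm" where
  "eta_R M = (\<lambda>a\<in>Field P. into_lim (up_cat P \<rho> r a) C M (Omap M a) (\<lambda>y. Amap M (a, y)))"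

definition e_map :: "('u, 'o, 'm) pfunc \<Rightarrow> 'u \<Rightarrow> 'm" where
  "e_map M = nt_comp (poset_cat P) C (eta_R M) (eta_L M)"

definition height_interleaved :: "('u, 'o, 'm) pfunc \<Rightarrow> ('u, 'o, 'm) pfunc \<Rightarrow> bool" where
  "height_interleaved M N \<longleftrightarrow> (\<exists>p q.
     is_nat_trans (poset_cat P) C M (R_fun N) p \<and>
     is_nat_trans (poset_cat P) C N (R_fun M) q \<and>
     e_map M = nt_comp (poset_cat P) C q (sharp M N p) \<and>
     e_map N = nt_comp (poset_cat P) C p (sharp N M q))"

end

definition interleaving_dist ::
  "('o, 'm) cat \<Rightarrow> 'u rel \<Rightarrow> ('u \<Rightarrow> 'u \<Rightarrow> ennreal) \<Rightarrow> ('u, 'o, 'm) pfunc \<Rightarrow> ('u, 'o, 'm) pfunc \<Rightarrow> ennreal"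
  where
  "interleaving_dist C P \<rho> M N = (INF r\<in>{r. 0 \<le> r \<and> height_interleaved C P \<rho> r M N}. ennreal r)"

end

(* Testing morphisms against the canonical maps of the limits and colimits, an r-height-interleaving
   is the same as two families M(x) \<rightarrow> N(y) and N(x) \<rightarrow> M(y), indexed by the pairs x \<le> y with
   \<rho>(x, y) \<ge> r and natural in x and y, whose composites M(x) \<rightarrow> N(a) \<rightarrow> M(y) and
   N(x) \<rightarrow> M(a) \<rightarrow> N(y) are structure maps. Such families can be reindexed along f, whereas the
   limits and colimits themselves do not commute with f^*. *)

theory Submission
  imports Defs
begin

section \<open>Chosen limits and colimits\<close>

lemma is_functor_Amap_in_hom:
  "is_functor J C F \<Longrightarrow> u \<in> Arr J \<Longrightarrow> Amap F u \<in> hom C (Omap F (Dom J u)) (Omap F (Cod J u))"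
  by (simp add: is_functor_def)

context category
begin

lemma hom_Obj: "f \<in> hom C a b \<Longrightarrow> a \<in> Obj C \<and> b \<in> Obj C"
  using Dom_in_Obj Cod_in_Obj by (auto simp: hom_def)

lemma is_cone_Comp:
  assumes "category J" "is_functor J C F" "is_cone J C F c l" "g \<in> hom C d c"
  shows "is_cone J C F d (\<lambda>j. Comp C (l j) g)"
proof -
  interpret J: category J by fact
  have "Comp C (Amap F u) (Comp C (l (Dom J u)) g) = Comp C (l (Cod J u)) g" if "u \<in> Arr J" for u
    using Comp_assoc[OF assms(4) _ is_functor_Amap_in_hom[OF assms(2) that]] assms(3)
      that J.Dom_in_Obj[OF that] by (simp add: is_cone_def)
  then show ?thesis
    using assms(3,4) hom_Obj Comp_in_hom unfolding is_cone_def by blast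
qed

lemma is_cocone_Comp:
  assumes "category J" "is_functor J C F" "is_cocone J C F c l" "g \<in> hom C c d"
  shows "is_cocone J C F d (\<lambda>j. Comp C g (l j))"
proof -
  interpret J: category J by fact
  have "Comp C (Comp C g (l (Cod J u))) (Amap F u) = Comp C g (l (Dom J u))" if "u \<in> Arr J" for u
  proof -
    have "l (Cod J u) \<in> hom C (Omap F (Cod J u)) c"
      using assms(3) J.Cod_in_Obj[OF that] by (simp add: is_cocone_def)
    from Comp_assoc[OF is_functor_Amap_in_hom[OF assms(2) that] this assms(4)] show ?thesis
      using assms(3) that by (simp add: is_cocone_def)
  qed
  then show ?thesis
    using assms(3,4) hom_Obj Comp_in_hom unfolding is_cocone_def by blast
qed

text \<open>Composing the legs with \<open>g\<close> gives a cone through which both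
  \<open>g\<close> and \<open>h\<close> factor, so the uniqueness half of the universal property
  applies.\<close>

lemma is_limit_jointly_monic:
  assumes "category J" "is_functor J C F" "is_limit J C F c l"
    and "g \<in> hom C d c" "h \<in> hom C d c"
    and "\<And>j. j \<in> Obj J \<Longrightarrow> Comp C (l j) g = Comp C (l j) h"
  shows "g = h"
proof -
  have "is_cone J C F d (\<lambda>j. Comp C (l j) g)"
    using is_cone_Comp assms unfolding is_limit_def by blast
  then have "\<exists>!k. k \<in> hom C d c \<and> (\<forall>j\<in>Obj J. Comp C (l j) k = Comp C (l j) g)"
    using assms(3) unfolding is_limit_def by blast
  then show ?thesis
    using assms(4-6) by metis
qed

lemma is_colimit_jointly_epic:
  assumes "category J" "is_functor J C F" "is_colimit J C F c l"
    and "g \<in> hom C c d" "h \<in> hom C c d"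
    and "\<And>j. j \<in> Obj J \<Longrightarrow> Comp C g (l j) = Comp C h (l j)"
  shows "g = h"
proof -
  have "is_cocone J C F d (\<lambda>j. Comp C g (l j))"
    using is_cocone_Comp assms unfolding is_colimit_def by blast
  then have "\<exists>!k. k \<in> hom C c d \<and> (\<forall>j\<in>Obj J. Comp C k (l j) = Comp C g (l j))"
    using assms(3) unfolding is_colimit_def by blast
  then show ?thesis
    using assms(4-6) by metis
qed

end

text \<open>\<open>lim_cone\<close> is a \<open>SOME\<close> choice, so completeness is what makes
  it a limit. The type of \<open>J\<close> is the type of small diagrams over which completeness
  quantifies.\<close>

lemma is_limit_lim_cone:
  fixes J :: "('u, 'u \<times> 'u) cat"
  assumes "complete_category TYPE('u) C" "category J" "is_functor J C F"
  shows "is_limit J C F (fst (lim_cone J C F)) (snd (lim_cone J C F))"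
proof -
  have "\<exists>x. case x of (c, l) \<Rightarrow> is_limit J C F c l"
    using assms unfolding complete_category_def by simp
  from someI_ex[OF this] show ?thesis
    by (simp add: lim_cone_def case_prod_unfold)
qed

lemma is_colimit_colim_cocone:
  fixes J :: "('u, 'u \<times> 'u) cat"
  assumes "cocomplete_category TYPE('u) C" "category J" "is_functor J C F"
  shows "is_colimit J C F (fst (colim_cocone J C F)) (snd (colim_cocone J C F))"
proof -
  have "\<exists>x. case x of (c, l) \<Rightarrow> is_colimit J C F c l"
    using assms unfolding cocomplete_category_def by simp
  from someI_ex[OF this] show ?thesis
    by (simp add: colim_cocone_def case_prod_unfold)
qed

lemma into_lim:
  assumes "is_limit J C F (fst (lim_cone J C F)) (snd (lim_cone J C F))" "is_cone J C F d k"
  shows "into_lim J C F d k \<in> hom C d (fst (lim_cone J C F)) \<and>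
    (\<forall>j\<in>Obj J. Comp C (snd (lim_cone J C F) j) (into_lim J C F d k) = k j)"
  unfolding into_lim_def by (rule theI') (use assms in \<open>unfold is_limit_def, blast\<close>)

lemma from_colim:
  assumes "is_colimit J C F (fst (colim_cocone J C F)) (snd (colim_cocone J C F))"
    and "is_cocone J C F d k"
  shows "from_colim J C F d k \<in> hom C (fst (colim_cocone J C F)) d \<and>
    (\<forall>j\<in>Obj J. Comp C (from_colim J C F d k) (snd (colim_cocone J C F) j) = k j)"
  unfolding from_colim_def by (rule theI') (use assms in \<open>unfold is_colimit_def, blast\<close>)

section \<open>Interleavings as families of morphisms\<close>

text \<open>The limit-free form of a morphism from M to the right shift of N: \<phi> is constrained
  only on pairs \<open>x \<le> y\<close> of height at least \<open>r\<close>. The two naturality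
  clauses make sense because lowering \<open>x\<close> or raising \<open>y\<close> keeps a pair in
  this range (\<open>down_extend\<close>).\<close>

definition shift_family ::
  "('o, 'm) cat \<Rightarrow> 'u rel \<Rightarrow> ('u \<Rightarrow> 'u \<Rightarrow> ennreal) \<Rightarrow> real \<Rightarrow>
    ('u, 'o, 'm) pfunc \<Rightarrow> ('u, 'o, 'm) pfunc \<Rightarrow> ('u \<Rightarrow> 'u \<Rightarrow> 'm) \<Rightarrow> bool" where
  "shift_family C P \<rho> r M N \<phi> \<longleftrightarrow>
     (\<forall>y. \<forall>x\<in>down P \<rho> r y. \<phi> x y \<in> hom C (Omap M x) (Omap N y)) \<and>
     (\<forall>y. \<forall>x\<in>down P \<rho> r y. \<forall>w. (w, x) \<in> P \<longrightarrow> Comp C (\<phi> x y) (Amap M (w, x)) = \<phi> w y) \<and>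
     (\<forall>y. \<forall>x\<in>down P \<rho> r y. \<forall>z. (y, z) \<in> P \<longrightarrow> Comp C (Amap N (y, z)) (\<phi> x y) = \<phi> x z)"

text \<open>The equation between \<open>e_map\<close> and the composite of \<open>q\<close> with the
  adjoint of \<open>p\<close>, seen between the colimit leg at \<open>x\<close> and the limit leg at
  \<open>y\<close>. An interleaving needs it for M and, with the families exchanged, for N.\<close>

definition inverse_shifts ::
  "('o, 'm) cat \<Rightarrow> 'u rel \<Rightarrow> ('u \<Rightarrow> 'u \<Rightarrow> ennreal) \<Rightarrow> real \<Rightarrow>
    ('u, 'o, 'm) pfunc \<Rightarrow> ('u \<Rightarrow> 'u \<Rightarrow> 'm) \<Rightarrow> ('u \<Rightarrow> 'u \<Rightarrow> 'm) \<Rightarrow> bool" where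
  "inverse_shifts C P \<rho> r M \<phi> \<psi> \<longleftrightarrow>
     (\<forall>a. \<forall>x\<in>down P \<rho> r a. \<forall>y\<in>up P \<rho> r a. Comp C (\<psi> a y) (\<phi> x a) = Amap M (x, y))"

lemma is_functor_poset_cat:
  "is_functor (poset_cat P) C M \<longleftrightarrow>
     (\<forall>x\<in>Field P. Omap M x \<in> Obj C) \<and>
     (\<forall>x y. (x, y) \<in> P \<longrightarrow> Amap M (x, y) \<in> hom C (Omap M x) (Omap M y)) \<and>
     (\<forall>x\<in>Field P. Amap M (x, x) = Ident C (Omap M x)) \<and>
     (\<forall>x y z. (x, y) \<in> P \<and> (y, z) \<in> P \<longrightarrow>
       Comp C (Amap M (y, z)) (Amap M (x, y)) = Amap M (x, z))"
  by (auto simp: is_functor_def poset_cat_def Ball_def split_paired_All eq_commute[of "Amap M _"])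

text \<open>Packaged as a locale so that the description of interleavings by families can be
  instantiated twice, over \<open>P\<close> and over the source of the order-preserving map.\<close>

locale height_poset =
  category C for C :: "('o, 'm) cat" +
  fixes P :: "'u rel" and \<rho> :: "'u \<Rightarrow> 'u \<Rightarrow> ennreal" and r :: real
  assumes complete: "complete_category TYPE('u) C"
    and cocomplete: "cocomplete_category TYPE('u) C"
    and partial_order: "Partial_order P"
    and height: "height_difference P \<rho>"
begin

section \<open>Pairs of height at least \<open>r\<close> in a poset\<close>

lemma poset_refl: "a \<in> Field P \<Longrightarrow> (a, a) \<in> P"
  using partial_order by (simp add: partial_order_on_def preorder_on_def refl_on_def)

lemma poset_trans: "(a, b) \<in> P \<Longrightarrow> (b, c) \<in> P \<Longrightarrow> (a, c) \<in> P"
  using partial_order by (auto simp: partial_order_on_def preorder_on_def dest: transD)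

text \<open>The same pairs index the colimits (upper end fixed) and the limits (lower end fixed),
  which lets a single family \<phi> serve both.\<close>

lemma down_iff_up: "x \<in> down P \<rho> r a \<longleftrightarrow> a \<in> up P \<rho> r x"
  by (auto simp: down_def up_def Field_def)

lemma down_poset: "x \<in> down P \<rho> r a \<Longrightarrow> (x, a) \<in> P"
  by (simp add: down_def)

lemma up_poset: "x \<in> up P \<rho> r a \<Longrightarrow> (a, x) \<in> P"
  by (simp add: up_def)

lemma in_Field: "(x, y) \<in> P \<Longrightarrow> x \<in> Field P \<and> y \<in> Field P"
  by (auto simp: Field_def)

lemma height_add_le: "(a, b) \<in> P \<Longrightarrow> (b, c) \<in> P \<Longrightarrow> \<rho> a b + \<rho> b c \<le> \<rho> a c"
  using height by (simp add: height_difference_def)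

text \<open>Superadditivity together with nonnegativity makes \<rho> grow when an interval is
  enlarged at either end. This gives the inclusions between index sets behind the structure maps of
  L and R.\<close>

lemma down_extend:
  assumes "x \<in> down P \<rho> r y" "(w, x) \<in> P" "(y, z) \<in> P"
  shows "w \<in> down P \<rho> r z"
proof -
  have xy: "(x, y) \<in> P" "ennreal r \<le> \<rho> x y"
    using assms(1) by (auto simp: down_def)
  have "\<rho> x y \<le> \<rho> w y"
    using height_add_le[OF assms(2) xy(1)] by (meson add_increasing order_trans zero_le order_refl)
  also have "\<dots> \<le> \<rho> w z"
    using height_add_le[OF poset_trans[OF assms(2) xy(1)] assms(3)]
    by (meson add_increasing2 order_trans zero_le order_refl)
  finally have "ennreal r \<le> \<rho> w z"
    using xy(2) by simp
  moreover have "(w, z) \<in> P"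
    using poset_trans[OF poset_trans[OF assms(2) xy(1)] assms(3)] .
  ultimately show ?thesis
    by (auto simp: down_def Field_def)
qed

text \<open>A poset is only its relation here, so an element survives restriction because of its
  reflexive pair.\<close>

lemma Field_Restr:
  assumes "S \<subseteq> Field P"
  shows "Field (Restr P S) = S"
proof
  show "Field (Restr P S) \<subseteq> S"
    by (auto simp: Field_def)
  show "S \<subseteq> Field (Restr P S)"
  proof
    fix x assume "x \<in> S"
    then have "(x, x) \<in> Restr P S"
      using assms poset_refl by blast
    then show "x \<in> Field (Restr P S)"
      by (rule FieldI1)
  qed
qed

lemma Obj_down_cat [simp]:
  "Obj (down_cat P \<rho> r a) = down P \<rho> r a"
  by (simp add: poset_cat_def Field_Restr down_def)

lemma Obj_up_cat [simp]:
  "Obj (up_cat P \<rho> r a) = up P \<rho> r a"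
  by (simp add: poset_cat_def Field_Restr up_def)

lemma category_Restr: "category (poset_cat (Restr P S))"
  using partial_order by (intro category_poset_cat Partial_order_Restr)

lemma Amap_in_hom:
  "is_functor (poset_cat P) C M \<Longrightarrow> (x, y) \<in> P \<Longrightarrow> Amap M (x, y) \<in> hom C (Omap M x) (Omap M y)"
  by (auto simp: is_functor_poset_cat)

lemma Amap_Comp:
  "is_functor (poset_cat P) C M \<Longrightarrow> (x, y) \<in> P \<Longrightarrow> (y, z) \<in> P
    \<Longrightarrow> Comp C (Amap M (y, z)) (Amap M (x, y)) = Amap M (x, z)"
  unfolding is_functor_poset_cat by blast

lemma Omap_Obj: "is_functor (poset_cat P) C M \<Longrightarrow> x \<in> Field P \<Longrightarrow> Omap M x \<in> Obj C"
  by (simp add: is_functor_poset_cat)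

lemma is_functor_Restr:
  assumes "is_functor (poset_cat P) C M"
  shows "is_functor (poset_cat (Restr P S)) C M"
proof -
  have "Field (Restr P S) \<subseteq> Field P"
    by (auto simp: Field_def)
  then show ?thesis
    using assms unfolding is_functor_poset_cat by blast
qed

lemma is_cone_up:
  "is_cone (up_cat P \<rho> r a) C M c l \<longleftrightarrow> c \<in> Obj C \<and>
     (\<forall>x\<in>up P \<rho> r a. l x \<in> hom C c (Omap M x)) \<and>
     (\<forall>x\<in>up P \<rho> r a. \<forall>y\<in>up P \<rho> r a. (x, y) \<in> P \<longrightarrow> Comp C (Amap M (x, y)) (l x) = l y)"
  unfolding is_cone_def Obj_up_cat by (auto simp: poset_cat_def Ball_def split_paired_All)

lemma is_cocone_down:
  "is_cocone (down_cat P \<rho> r a) C M c l \<longleftrightarrow> c \<in> Obj C \<and>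
     (\<forall>x\<in>down P \<rho> r a. l x \<in> hom C (Omap M x) c) \<and>
     (\<forall>x\<in>down P \<rho> r a. \<forall>y\<in>down P \<rho> r a. (x, y) \<in> P \<longrightarrow> Comp C (l y) (Amap M (x, y)) = l x)"
  unfolding is_cocone_def Obj_down_cat by (auto simp: poset_cat_def Ball_def split_paired_All)

section \<open>Universal properties of the functors L and R\<close>

context
  fixes M :: "('u, 'o, 'm) pfunc"
  assumes M: "is_functor (poset_cat P) C M"
begin

lemma is_limit_R: "is_limit (up_cat P \<rho> r a) C M (R_obj C P \<rho> r M a) (beta C P \<rho> r M a)"
  unfolding R_obj_def beta_def
  by (intro is_limit_lim_cone complete category_Restr is_functor_Restr M)

lemma is_colimit_L: "is_colimit (down_cat P \<rho> r a) C M (L_obj C P \<rho> r M a) (alpha C P \<rho> r M a)"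
  unfolding L_obj_def alpha_def
  by (intro is_colimit_colim_cocone cocomplete category_Restr is_functor_Restr M)

lemma R_cone: "is_cone (up_cat P \<rho> r a) C M (R_obj C P \<rho> r M a) (beta C P \<rho> r M a)"
  using is_limit_R by (simp add: is_limit_def)

lemma L_cocone: "is_cocone (down_cat P \<rho> r a) C M (L_obj C P \<rho> r M a) (alpha C P \<rho> r M a)"
  using is_colimit_L by (simp add: is_colimit_def)

lemma beta_in_hom: "x \<in> up P \<rho> r a \<Longrightarrow> beta C P \<rho> r M a x \<in> hom C (R_obj C P \<rho> r M a) (Omap M x)"
  using R_cone by (simp add: is_cone_up)

lemma alpha_in_hom: "x \<in> down P \<rho> r a \<Longrightarrow> alpha C P \<rho> r M a x \<in> hom C (Omap M x) (L_obj C P \<rho> r M a)"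
  using L_cocone by (simp add: is_cocone_down)

lemma into_R:
  assumes "is_cone (up_cat P \<rho> r a) C M d k"
  shows "into_lim (up_cat P \<rho> r a) C M d k \<in> hom C d (R_obj C P \<rho> r M a)"
    and "x \<in> up P \<rho> r a \<Longrightarrow>
      Comp C (beta C P \<rho> r M a x) (into_lim (up_cat P \<rho> r a) C M d k) = k x"
  using into_lim[OF is_limit_R[of a, unfolded R_obj_def beta_def] assms]
  by (simp_all add: R_obj_def beta_def)

lemma from_L:
  assumes "is_cocone (down_cat P \<rho> r a) C M d k"
  shows "from_colim (down_cat P \<rho> r a) C M d k \<in> hom C (L_obj C P \<rho> r M a) d"
    and "x \<in> down P \<rho> r a \<Longrightarrow>
      Comp C (from_colim (down_cat P \<rho> r a) C M d k) (alpha C P \<rho> r M a x) = k x"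
  using from_colim[OF is_colimit_L[of a, unfolded L_obj_def alpha_def] assms]
  by (simp_all add: L_obj_def alpha_def)

lemma R_jointly_monic:
  assumes "g \<in> hom C d (R_obj C P \<rho> r M a)" "h \<in> hom C d (R_obj C P \<rho> r M a)"
    and "\<And>x. x \<in> up P \<rho> r a \<Longrightarrow> Comp C (beta C P \<rho> r M a x) g = Comp C (beta C P \<rho> r M a x) h"
  shows "g = h"
  using is_limit_jointly_monic[OF category_Restr is_functor_Restr[OF M] is_limit_R assms(1,2)]
    assms(3) by simp

lemma L_jointly_epic:
  assumes "g \<in> hom C (L_obj C P \<rho> r M a) d" "h \<in> hom C (L_obj C P \<rho> r M a) d"
    and "\<And>x. x \<in> down P \<rho> r a \<Longrightarrow> Comp C g (alpha C P \<rho> r M a x) = Comp C h (alpha C P \<rho> r M a x)"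
  shows "g = h"
  using is_colimit_jointly_epic[OF category_Restr is_functor_Restr[OF M] is_colimit_L assms(1,2)]
    assms(3) by simp

text \<open>The legs out of the limit are jointly monic and the legs into the colimit jointly epic,
  so a morphism from the colimit to the limit is determined by its matrix of composites from M(x) to
  M(y). The interleaving equations compare morphisms of exactly this kind.\<close>

lemma L_R_eqI:
  assumes "g \<in> hom C (L_obj C P \<rho> r M a) (R_obj C P \<rho> r M a)"
    and "h \<in> hom C (L_obj C P \<rho> r M a) (R_obj C P \<rho> r M a)"
    and "\<And>x y. x \<in> down P \<rho> r a \<Longrightarrow> y \<in> up P \<rho> r a \<Longrightarrow>
      Comp C (beta C P \<rho> r M a y) (Comp C g (alpha C P \<rho> r M a x)) =
      Comp C (beta C P \<rho> r M a y) (Comp C h (alpha C P \<rho> r M a x))"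
  shows "g = h"
proof (rule L_jointly_epic[OF assms(1,2)])
  fix x assume x: "x \<in> down P \<rho> r a"
  show "Comp C g (alpha C P \<rho> r M a x) = Comp C h (alpha C P \<rho> r M a x)"
    using Comp_in_hom[OF alpha_in_hom[OF x] assms(1)] Comp_in_hom[OF alpha_in_hom[OF x] assms(2)]
      assms(3)[OF x] by (rule R_jointly_monic)
qed

lemma R_fun_Amap:
  assumes "(a, b) \<in> P"
  shows "Amap (R_fun C P \<rho> r M) (a, b) \<in> hom C (R_obj C P \<rho> r M a) (R_obj C P \<rho> r M b)"
    and "x \<in> up P \<rho> r b \<Longrightarrow>
      Comp C (beta C P \<rho> r M b x) (Amap (R_fun C P \<rho> r M) (a, b)) = beta C P \<rho> r M a x"
proof -
  \<comment> \<open>This is \<open>down_extend\<close> read from the other end: for \<open>x\<close>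
    above \<open>b\<close>, the lower end \<open>b\<close> of the pair is replaced by
    \<open>a\<close>.\<close>
  have "up P \<rho> r b \<subseteq> up P \<rho> r a"
    using assms down_extend poset_refl in_Field unfolding subset_iff down_iff_up[symmetric]
    by (meson down_poset)
  then have "is_cone (up_cat P \<rho> r b) C M (R_obj C P \<rho> r M a) (beta C P \<rho> r M a)"
    using R_cone[of a] unfolding is_cone_up by blast
  from into_R[OF this]
  show "Amap (R_fun C P \<rho> r M) (a, b) \<in> hom C (R_obj C P \<rho> r M a) (R_obj C P \<rho> r M b)"
    and "x \<in> up P \<rho> r b \<Longrightarrow>
      Comp C (beta C P \<rho> r M b x) (Amap (R_fun C P \<rho> r M) (a, b)) = beta C P \<rho> r M a x"
    by (simp_all add: R_fun_def)
qed

lemma L_fun_Amap: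
  assumes "(a, b) \<in> P"
  shows "Amap (L_fun C P \<rho> r M) (a, b) \<in> hom C (L_obj C P \<rho> r M a) (L_obj C P \<rho> r M b)"
    and "x \<in> down P \<rho> r a \<Longrightarrow>
      Comp C (Amap (L_fun C P \<rho> r M) (a, b)) (alpha C P \<rho> r M a x) = alpha C P \<rho> r M b x"
proof -
  have "down P \<rho> r a \<subseteq> down P \<rho> r b"
    using assms down_extend poset_refl in_Field by (meson down_poset subsetI)
  then have "is_cocone (down_cat P \<rho> r a) C M (L_obj C P \<rho> r M b) (alpha C P \<rho> r M b)"
    using L_cocone[of b] unfolding is_cocone_down by blast
  from from_L[OF this]
  show "Amap (L_fun C P \<rho> r M) (a, b) \<in> hom C (L_obj C P \<rho> r M a) (L_obj C P \<rho> r M b)"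
    and "x \<in> down P \<rho> r a \<Longrightarrow>
      Comp C (Amap (L_fun C P \<rho> r M) (a, b)) (alpha C P \<rho> r M a x) = alpha C P \<rho> r M b x"
    by (simp_all add: L_fun_def)
qed

text \<open>Functoriality of \<open>M\<close> makes its structure maps out of \<open>a\<close> a
  cone, so the induced map exists and has the prescribed composites.\<close>

lemma eta_R:
  assumes "a \<in> Field P"
  shows "eta_R C P \<rho> r M a \<in> hom C (Omap M a) (R_obj C P \<rho> r M a)"
    and "x \<in> up P \<rho> r a \<Longrightarrow> Comp C (beta C P \<rho> r M a x) (eta_R C P \<rho> r M a) = Amap M (a, x)"
proof -
  have "is_cone (up_cat P \<rho> r a) C M (Omap M a) (\<lambda>y. Amap M (a, y))"
    unfolding is_cone_up
    using Omap_Obj[OF M assms] Amap_in_hom[OF M] Amap_Comp[OF M] up_poset by blast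
  from into_R[OF this] assms
  show "eta_R C P \<rho> r M a \<in> hom C (Omap M a) (R_obj C P \<rho> r M a)"
    and "x \<in> up P \<rho> r a \<Longrightarrow> Comp C (beta C P \<rho> r M a x) (eta_R C P \<rho> r M a) = Amap M (a, x)"
    by (simp_all add: eta_R_def)
qed

lemma eta_L:
  assumes "a \<in> Field P"
  shows "eta_L C P \<rho> r M a \<in> hom C (L_obj C P \<rho> r M a) (Omap M a)"
    and "x \<in> down P \<rho> r a \<Longrightarrow> Comp C (eta_L C P \<rho> r M a) (alpha C P \<rho> r M a x) = Amap M (x, a)"
proof -
  have "is_cocone (down_cat P \<rho> r a) C M (Omap M a) (\<lambda>y. Amap M (y, a))"
    unfolding is_cocone_down
    using Omap_Obj[OF M assms] Amap_in_hom[OF M] Amap_Comp[OF M] down_poset by blast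
  from from_L[OF this] assms
  show "eta_L C P \<rho> r M a \<in> hom C (L_obj C P \<rho> r M a) (Omap M a)"
    and "x \<in> down P \<rho> r a \<Longrightarrow> Comp C (eta_L C P \<rho> r M a) (alpha C P \<rho> r M a x) = Amap M (x, a)"
    by (simp_all add: eta_L_def)
qed

text \<open>Pure reassociation: a map from colimit to limit that factors through \<open>b\<close>
  splits into an incoming and an outgoing half. It is applied with \<open>b\<close> the value of M
  at \<open>a\<close> for \<open>e_map\<close>, and the value of N at \<open>a\<close> for the
  composite of \<open>q\<close> with the adjoint of \<open>p\<close>.\<close>

lemma beta_Comp_alpha:
  assumes "g \<in> hom C (L_obj C P \<rho> r M a) b" "h \<in> hom C b (R_obj C P \<rho> r M a)"
    and "x \<in> down P \<rho> r a" "y \<in> up P \<rho> r a"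
  shows "Comp C (beta C P \<rho> r M a y) (Comp C (Comp C h g) (alpha C P \<rho> r M a x)) =
    Comp C (Comp C (beta C P \<rho> r M a y) h) (Comp C g (alpha C P \<rho> r M a x))"
proof -
  note al = alpha_in_hom[OF assms(3)] and be = beta_in_hom[OF assms(4)]
  show ?thesis
    using Comp_assoc[OF al assms(1,2)] Comp_assoc[OF Comp_in_hom[OF al assms(1)] assms(2) be]
    by simp
qed

text \<open>Between the legs, the two halves become the structure maps from \<open>x\<close> to
  \<open>a\<close> and from \<open>a\<close> to \<open>y\<close>, whose composite is the structure
  map from \<open>x\<close> to \<open>y\<close>.\<close>

lemma e_map:
  assumes "a \<in> Field P"
  shows "e_map C P \<rho> r M a \<in> hom C (L_obj C P \<rho> r M a) (R_obj C P \<rho> r M a)"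
    and "x \<in> down P \<rho> r a \<Longrightarrow> y \<in> up P \<rho> r a \<Longrightarrow>
      Comp C (beta C P \<rho> r M a y) (Comp C (e_map C P \<rho> r M a) (alpha C P \<rho> r M a x)) =
      Amap M (x, y)"
proof -
  have e: "e_map C P \<rho> r M a = Comp C (eta_R C P \<rho> r M a) (eta_L C P \<rho> r M a)"
    using assms by (simp add: e_map_def nt_comp_def poset_cat_def)
  show "e_map C P \<rho> r M a \<in> hom C (L_obj C P \<rho> r M a) (R_obj C P \<rho> r M a)"
    unfolding e using eta_L(1) eta_R(1) assms by (blast intro: Comp_in_hom)
  show "Comp C (beta C P \<rho> r M a y) (Comp C (e_map C P \<rho> r M a) (alpha C P \<rho> r M a x)) =
      Amap M (x, y)" if "x \<in> down P \<rho> r a" "y \<in> up P \<rho> r a"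
    using beta_Comp_alpha[OF eta_L(1) eta_R(1) that] eta_L(2) eta_R(2) Amap_Comp[OF M] assms that
      up_poset down_poset by (simp add: e)
qed

end

section \<open>Morphisms into R, their adjoints, and shift families\<close>

context
  fixes M N :: "('u, 'o, 'm) pfunc"
  assumes M: "is_functor (poset_cat P) C M" and N: "is_functor (poset_cat P) C N"
begin

text \<open>Naturality in the source comes from naturality of \<open>p\<close> and the action of R
  on arrows; naturality in the target is the cone equation for \<open>beta\<close>.\<close>

lemma shift_family_of_nat_trans:
  assumes p: "is_nat_trans (poset_cat P) C M (R_fun C P \<rho> r N) p"
  shows "shift_family C P \<rho> r M N (\<lambda>x y. Comp C (beta C P \<rho> r N x y) (p x))"
proof -
  have p_hom: "p x \<in> hom C (Omap M x) (R_obj C P \<rho> r N x)" if "x \<in> Field P" for x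
    using p that by (simp add: is_nat_trans_def poset_cat_def R_fun_def)
  have p_nat: "Comp C (p y) (Amap M (x, y)) = Comp C (Amap (R_fun C P \<rho> r N) (x, y)) (p x)"
    if "(x, y) \<in> P" for x y
    using p that by (force simp: is_nat_trans_def poset_cat_def)
  show ?thesis
    unfolding shift_family_def
  proof (intro conjI allI ballI impI)
    fix x y assume xy: "x \<in> down P \<rho> r y"
    have x: "x \<in> Field P" and y: "y \<in> up P \<rho> r x"
      using xy down_iff_up by (auto simp: down_def)
    note be = beta_in_hom[OF N y]
    show "Comp C (beta C P \<rho> r N x y) (p x) \<in> hom C (Omap M x) (Omap N y)"
      using Comp_in_hom[OF p_hom[OF x] be] .
    show "Comp C (Comp C (beta C P \<rho> r N x y) (p x)) (Amap M (w, x)) =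
      Comp C (beta C P \<rho> r N w y) (p w)" if "(w, x) \<in> P" for w
    proof -
      have w: "w \<in> Field P" using that in_Field by blast
      show ?thesis
        using Comp_assoc[OF Amap_in_hom[OF M that] p_hom[OF x] be] p_nat[OF that]
          Comp_assoc[OF p_hom[OF w] R_fun_Amap(1)[OF N that] be] R_fun_Amap(2)[OF N that y]
        by simp
    qed
    show "Comp C (Amap N (y, z)) (Comp C (beta C P \<rho> r N x y) (p x)) =
      Comp C (beta C P \<rho> r N x z) (p x)" if "(y, z) \<in> P" for z
    proof -
      have z: "z \<in> up P \<rho> r x"
        using down_extend[OF xy poset_refl[OF x] that] down_iff_up by blast
      show ?thesis
        using Comp_assoc[OF p_hom[OF x] be Amap_in_hom[OF N that]] R_cone[OF N, of x] y z that
        unfolding is_cone_up by simp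
    qed
  qed
qed

text \<open>For fixed \<open>x\<close>, naturality of \<phi> in the target says that
  \<open>\<phi> x\<close> is a cone over N with vertex M(x); the induced map is the component of
  \<open>p\<close> at \<open>x\<close>.\<close>

lemma nat_trans_of_shift_family:
  assumes \<phi>: "shift_family C P \<rho> r M N \<phi>"
  obtains p where "is_nat_trans (poset_cat P) C M (R_fun C P \<rho> r N) p"
    and "\<And>x y. x \<in> down P \<rho> r y \<Longrightarrow> Comp C (beta C P \<rho> r N x y) (p x) = \<phi> x y"
proof -
  define p where "p = (\<lambda>x\<in>Field P. into_lim (up_cat P \<rho> r x) C N (Omap M x) (\<phi> x))"
  have cone: "is_cone (up_cat P \<rho> r x) C N (Omap M x) (\<phi> x)" if "x \<in> Field P" for x
    using \<phi> Omap_Obj[OF M that] by (auto simp: is_cone_up shift_family_def down_iff_up)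
  have p_hom: "p x \<in> hom C (Omap M x) (R_obj C P \<rho> r N x)" if "x \<in> Field P" for x
    using into_R(1)[OF N cone[OF that]] that by (simp add: p_def)
  have p_beta: "Comp C (beta C P \<rho> r N x y) (p x) = \<phi> x y" if "x \<in> down P \<rho> r y" for x y
  proof -
    have x: "x \<in> Field P" and y: "y \<in> up P \<rho> r x"
      using that down_iff_up by (auto simp: down_def)
    show ?thesis
      using into_R(2)[OF N cone[OF x] y] x by (simp add: p_def)
  qed
  have p_nat: "Comp C (p y) (Amap M (x, y)) = Comp C (Amap (R_fun C P \<rho> r N) (x, y)) (p x)"
    if xy: "(x, y) \<in> P" for x y
  proof -
    have x: "x \<in> Field P" and y: "y \<in> Field P"
      using xy in_Field by auto
    show ?thesis
    proof (rule R_jointly_monic[OF N])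
      show "Comp C (p y) (Amap M (x, y)) \<in> hom C (Omap M x) (R_obj C P \<rho> r N y)"
        using Comp_in_hom[OF Amap_in_hom[OF M xy] p_hom[OF y]] .
      show "Comp C (Amap (R_fun C P \<rho> r N) (x, y)) (p x) \<in> hom C (Omap M x) (R_obj C P \<rho> r N y)"
        using Comp_in_hom[OF p_hom[OF x] R_fun_Amap(1)[OF N xy]] .
      fix z assume z: "z \<in> up P \<rho> r y"
      then have yz: "y \<in> down P \<rho> r z"
        by (simp add: down_iff_up)
      have xz: "x \<in> down P \<rho> r z"
        using down_extend[OF yz xy] poset_refl in_Field down_poset[OF yz] by blast
      \<comment> \<open>Composed with the limit leg at \<open>z\<close>, the two sides of the
        naturality square for \<open>p\<close> become the two sides of this equation.\<close>
      have "Comp C (\<phi> y z) (Amap M (x, y)) = \<phi> x z"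
        using \<phi> yz xy unfolding shift_family_def by blast
      then show "Comp C (beta C P \<rho> r N y z) (Comp C (p y) (Amap M (x, y))) =
        Comp C (beta C P \<rho> r N y z) (Comp C (Amap (R_fun C P \<rho> r N) (x, y)) (p x))"
        using Comp_assoc[OF Amap_in_hom[OF M xy] p_hom[OF y] beta_in_hom[OF N z]]
          Comp_assoc[OF p_hom[OF x] R_fun_Amap(1)[OF N xy] beta_in_hom[OF N z]]
          R_fun_Amap(2)[OF N xy z] p_beta[OF yz] p_beta[OF xz] by simp
    qed
  qed
  have "p \<in> extensional (Field P)"
    by (simp add: p_def)
  then have "is_nat_trans (poset_cat P) C M (R_fun C P \<rho> r N) p"
    using p_hom p_nat by (auto simp: is_nat_trans_def poset_cat_def R_fun_def)
  then show thesis
    using p_beta that by blast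
qed

text \<open>This justifies the \<open>THE\<close> in \<open>sharp\<close>. Existence uses the family
  of \<open>p\<close> with its target fixed, where naturality in the source gives a cocone;
  uniqueness holds because the colimit legs are jointly epic.\<close>

lemma sharp:
  assumes p: "is_nat_trans (poset_cat P) C M (R_fun C P \<rho> r N) p"
  shows "is_nat_trans (poset_cat P) C (L_fun C P \<rho> r M) N (sharp C P \<rho> r M N p) \<and>
     (\<forall>a\<in>Field P. \<forall>x\<in>down P \<rho> r a.
       Comp C (sharp C P \<rho> r M N p a) (alpha C P \<rho> r M a x) = Comp C (beta C P \<rho> r N x a) (p x))"
  (is "?P (sharp C P \<rho> r M N p)")
  unfolding sharp_def
proof (rule theI'[of ?P], rule ex_ex1I)
  let ?\<phi> = "\<lambda>x y. Comp C (beta C P \<rho> r N x y) (p x)"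
  note \<phi> = shift_family_of_nat_trans[OF p]
  define s where "s = (\<lambda>a\<in>Field P. from_colim (down_cat P \<rho> r a) C M (Omap N a) (\<lambda>x. ?\<phi> x a))"
  have cocone: "is_cocone (down_cat P \<rho> r a) C M (Omap N a) (\<lambda>x. ?\<phi> x a)" if "a \<in> Field P" for a
    using \<phi> Omap_Obj[OF N that] unfolding is_cocone_down shift_family_def by blast
  have s_hom: "s a \<in> hom C (L_obj C P \<rho> r M a) (Omap N a)" if "a \<in> Field P" for a
    using from_L(1)[OF M cocone[OF that]] that by (simp add: s_def)
  have s_alpha: "Comp C (s a) (alpha C P \<rho> r M a x) = ?\<phi> x a"
    if "a \<in> Field P" "x \<in> down P \<rho> r a" for a x
    using from_L(2)[OF M cocone[OF that(1)] that(2)] that by (simp add: s_def)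
  have s_nat: "Comp C (s b) (Amap (L_fun C P \<rho> r M) (a, b)) = Comp C (Amap N (a, b)) (s a)"
    if ab: "(a, b) \<in> P" for a b
  proof -
    have a: "a \<in> Field P" and b: "b \<in> Field P"
      using ab in_Field by auto
    show ?thesis
    proof (rule L_jointly_epic[OF M])
      show "Comp C (s b) (Amap (L_fun C P \<rho> r M) (a, b)) \<in> hom C (L_obj C P \<rho> r M a) (Omap N b)"
        using Comp_in_hom[OF L_fun_Amap(1)[OF M ab] s_hom[OF b]] .
      show "Comp C (Amap N (a, b)) (s a) \<in> hom C (L_obj C P \<rho> r M a) (Omap N b)"
        using Comp_in_hom[OF s_hom[OF a] Amap_in_hom[OF N ab]] .
      fix x assume xa: "x \<in> down P \<rho> r a"
      have xb: "x \<in> down P \<rho> r b"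
        using down_extend[OF xa _ ab] poset_refl in_Field down_poset[OF xa] by blast
      \<comment> \<open>Precomposed with the colimit leg at \<open>x\<close>, the naturality square
        for \<open>s\<close> becomes this instance of naturality in the target.\<close>
      have "Comp C (Amap N (a, b)) (?\<phi> x a) = ?\<phi> x b"
        using \<phi> xa ab unfolding shift_family_def by blast
      then show "Comp C (Comp C (s b) (Amap (L_fun C P \<rho> r M) (a, b))) (alpha C P \<rho> r M a x) =
        Comp C (Comp C (Amap N (a, b)) (s a)) (alpha C P \<rho> r M a x)"
        using Comp_assoc[OF alpha_in_hom[OF M xa] L_fun_Amap(1)[OF M ab] s_hom[OF b]]
          Comp_assoc[OF alpha_in_hom[OF M xa] s_hom[OF a] Amap_in_hom[OF N ab]]
          L_fun_Amap(2)[OF M ab xa] s_alpha[OF a xa] s_alpha[OF b xb] by simp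
    qed
  qed
  have "s \<in> extensional (Field P)"
    by (simp add: s_def)
  then have "is_nat_trans (poset_cat P) C (L_fun C P \<rho> r M) N s"
    using s_hom s_nat by (auto simp: is_nat_trans_def poset_cat_def L_fun_def)
  then show "\<exists>s. is_nat_trans (poset_cat P) C (L_fun C P \<rho> r M) N s \<and>
    (\<forall>a\<in>Field P. \<forall>x\<in>down P \<rho> r a. Comp C (s a) (alpha C P \<rho> r M a x) = ?\<phi> x a)"
    using s_alpha by blast
next
  fix s t
  assume s: "is_nat_trans (poset_cat P) C (L_fun C P \<rho> r M) N s \<and> (\<forall>a\<in>Field P. \<forall>x\<in>down P \<rho> r a.
      Comp C (s a) (alpha C P \<rho> r M a x) = Comp C (beta C P \<rho> r N x a) (p x))"
    and t: "is_nat_trans (poset_cat P) C (L_fun C P \<rho> r M) N t \<and> (\<forall>a\<in>Field P. \<forall>x\<in>down P \<rho> r a.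
      Comp C (t a) (alpha C P \<rho> r M a x) = Comp C (beta C P \<rho> r N x a) (p x))"
  show "s = t"
  proof (rule extensionalityI[of _ "Field P"])
    show "s \<in> extensional (Field P)" "t \<in> extensional (Field P)"
      using s t by (auto simp: is_nat_trans_def poset_cat_def)
    show "s a = t a" if "a \<in> Field P" for a
      by (rule L_jointly_epic[OF M, of _ a "Omap N a"])
        (use s t that in \<open>auto simp: is_nat_trans_def poset_cat_def L_fun_def\<close>)
  qed
qed

text \<open>Both sides are families of maps from colimit to limit, so \<open>L_R_eqI\<close> reduces
  their equality to matrix entries: structure maps of M on one side, composites of the two families
  on the other.\<close>

lemma e_map_eq_iff:
  assumes p: "is_nat_trans (poset_cat P) C M (R_fun C P \<rho> r N) p"
    and q: "is_nat_trans (poset_cat P) C N (R_fun C P \<rho> r M) q"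
  shows "e_map C P \<rho> r M = nt_comp (poset_cat P) C q (sharp C P \<rho> r M N p) \<longleftrightarrow>
    inverse_shifts C P \<rho> r M (\<lambda>x y. Comp C (beta C P \<rho> r N x y) (p x))
      (\<lambda>x y. Comp C (beta C P \<rho> r M x y) (q x))"
proof -
  let ?e = "e_map C P \<rho> r M" and ?s = "sharp C P \<rho> r M N p"
  let ?\<phi> = "\<lambda>x y. Comp C (beta C P \<rho> r N x y) (p x)"
  let ?\<psi> = "\<lambda>x y. Comp C (beta C P \<rho> r M x y) (q x)"
  let ?between = "\<lambda>h a x y. Comp C (beta C P \<rho> r M a y) (Comp C h (alpha C P \<rho> r M a x))"
  have s_hom: "?s a \<in> hom C (L_obj C P \<rho> r M a) (Omap N a)" if "a \<in> Field P" for a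
    using sharp[OF p] that by (simp add: is_nat_trans_def poset_cat_def L_fun_def)
  have q_hom: "q a \<in> hom C (Omap N a) (R_obj C P \<rho> r M a)" if "a \<in> Field P" for a
    using q that by (simp add: is_nat_trans_def poset_cat_def R_fun_def)
  have between: "?between (Comp C (q a) (?s a)) a x y = Comp C (?\<psi> a y) (?\<phi> x a)"
    if "x \<in> down P \<rho> r a" "y \<in> up P \<rho> r a" for a x y
  proof -
    have a: "a \<in> Field P"
      using that(1) down_poset in_Field by blast
    show ?thesis
      using beta_Comp_alpha[OF M s_hom[OF a] q_hom[OF a] that] sharp[OF p] a that(1) by simp
  qed
  \<comment> \<open>Both transformations are \<open>nt_comp\<close> composites, hence extensional,
    and only components on the field matter.\<close>
  have "?e = nt_comp (poset_cat P) C q ?s \<longleftrightarrow> (\<forall>a\<in>Field P. ?e a = Comp C (q a) (?s a))"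
    unfolding e_map_def nt_comp_def by (auto simp: poset_cat_def fun_eq_iff)
  also have "\<dots> \<longleftrightarrow> (\<forall>a\<in>Field P. \<forall>x\<in>down P \<rho> r a. \<forall>y\<in>up P \<rho> r a.
      ?between (Comp C (q a) (?s a)) a x y = ?between (?e a) a x y)"
    using L_R_eqI[OF M e_map(1)[OF M] Comp_in_hom[OF s_hom q_hom]] by metis
  also have "\<dots> \<longleftrightarrow> inverse_shifts C P \<rho> r M ?\<phi> ?\<psi>"
    unfolding inverse_shifts_def
    using between e_map(2)[OF M] down_poset in_Field by (metis (no_types, lifting))
  finally show ?thesis .
qed

end

text \<open>Needed because \<open>nat_trans_of_shift_family\<close> recovers a given family only on
  pairs of height at least \<open>r\<close>.\<close>

lemma inverse_shifts_cong:
  assumes "\<And>x y. x \<in> down P \<rho> r y \<Longrightarrow> \<phi> x y = \<phi>' x y"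
    and "\<And>x y. x \<in> down P \<rho> r y \<Longrightarrow> \<psi> x y = \<psi>' x y"
  shows "inverse_shifts C P \<rho> r M \<phi> \<psi> \<longleftrightarrow> inverse_shifts C P \<rho> r M \<phi>' \<psi>'"
  using assms by (auto simp: inverse_shifts_def down_iff_up[symmetric])

text \<open>The right-hand side mentions no limit or colimit, which is what allows an interleaving
  to be transported along an order-preserving map.\<close>

lemma height_interleaved_iff_shifts:
  assumes M: "is_functor (poset_cat P) C M" and N: "is_functor (poset_cat P) C N"
  shows "height_interleaved C P \<rho> r M N \<longleftrightarrow>
    (\<exists>\<phi> \<psi>. shift_family C P \<rho> r M N \<phi> \<and> shift_family C P \<rho> r N M \<psi> \<and>
      inverse_shifts C P \<rho> r M \<phi> \<psi> \<and> inverse_shifts C P \<rho> r N \<psi> \<phi>)"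
proof
  assume "height_interleaved C P \<rho> r M N"
  then show "\<exists>\<phi> \<psi>. shift_family C P \<rho> r M N \<phi> \<and> shift_family C P \<rho> r N M \<psi> \<and>
      inverse_shifts C P \<rho> r M \<phi> \<psi> \<and> inverse_shifts C P \<rho> r N \<psi> \<phi>"
    unfolding height_interleaved_def
    using shift_family_of_nat_trans[OF M N] shift_family_of_nat_trans[OF N M]
      e_map_eq_iff[OF M N] e_map_eq_iff[OF N M] by blast
next
  assume "\<exists>\<phi> \<psi>. shift_family C P \<rho> r M N \<phi> \<and> shift_family C P \<rho> r N M \<psi> \<and>
      inverse_shifts C P \<rho> r M \<phi> \<psi> \<and> inverse_shifts C P \<rho> r N \<psi> \<phi>"
  then obtain \<phi> \<psi> where \<phi>: "shift_family C P \<rho> r M N \<phi>" and \<psi>: "shift_family C P \<rho> r N M \<psi>"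
    and inv: "inverse_shifts C P \<rho> r M \<phi> \<psi>" "inverse_shifts C P \<rho> r N \<psi> \<phi>"
    by blast
  obtain p where p: "is_nat_trans (poset_cat P) C M (R_fun C P \<rho> r N) p"
    and p_beta: "\<And>x y. x \<in> down P \<rho> r y \<Longrightarrow> Comp C (beta C P \<rho> r N x y) (p x) = \<phi> x y"
    using nat_trans_of_shift_family[OF M N \<phi>] by blast
  obtain q where q: "is_nat_trans (poset_cat P) C N (R_fun C P \<rho> r M) q"
    and q_beta: "\<And>x y. x \<in> down P \<rho> r y \<Longrightarrow> Comp C (beta C P \<rho> r M x y) (q x) = \<psi> x y"
    using nat_trans_of_shift_family[OF N M \<psi>] by blast
  have "e_map C P \<rho> r M = nt_comp (poset_cat P) C q (sharp C P \<rho> r M N p)"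
    unfolding e_map_eq_iff[OF M N p q]
    using inv(1)
    by (subst inverse_shifts_cong[where \<phi>' = \<phi> and \<psi>' = \<psi>]) (auto simp: p_beta q_beta)
  moreover have "e_map C P \<rho> r N = nt_comp (poset_cat P) C p (sharp C P \<rho> r N M q)"
    unfolding e_map_eq_iff[OF N M q p]
    using inv(2)
    by (subst inverse_shifts_cong[where \<phi>' = \<psi> and \<psi>' = \<phi>]) (auto simp: p_beta q_beta)
  ultimately show "height_interleaved C P \<rho> r M N"
    unfolding height_interleaved_def using p q by blast
qed

end

section \<open>Pullback along an order-preserving map\<close>

context
  fixes P Q :: "'u rel" and f :: "'u \<Rightarrow> 'u"
  assumes f: "order_preserving Q P f"
begin

lemma order_preservingD: "(x, y) \<in> Q \<Longrightarrow> (f x, f y) \<in> P" "x \<in> Field Q \<Longrightarrow> f x \<in> Field P"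
  using f by (auto simp: order_preserving_def)

lemma is_functor_pullback:
  assumes "is_functor (poset_cat P) C M"
  shows "is_functor (poset_cat Q) C (pullback f M)"
  using assms order_preservingD
  by (simp add: is_functor_poset_cat pullback_def)

lemma height_difference_pullback:
  "height_difference P \<rho> \<Longrightarrow> height_difference Q (pullback_height f \<rho>)"
  using order_preservingD unfolding height_difference_def pullback_height_def by blast

text \<open>Only this one-sided inclusion is available: \<open>f\<close> need not map onto the
  larger down-set. It suffices for families, whose conditions are universal over such pairs.\<close>

lemma down_pullback: "x \<in> down Q (pullback_height f \<rho>) r y \<Longrightarrow> f x \<in> down P \<rho> r (f y)"
  using order_preservingD by (auto simp: down_def pullback_height_def)

lemma up_pullback: "x \<in> up Q (pullback_height f \<rho>) r y \<Longrightarrow> f x \<in> up P \<rho> r (f y)"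
  using order_preservingD by (auto simp: up_def pullback_height_def)

text \<open>Each condition over \<open>Q\<close> is the instance over \<open>P\<close> at the images
  under \<open>f\<close>.\<close>

lemma shift_family_pullback:
  "shift_family C P \<rho> r M N \<phi> \<Longrightarrow>
    shift_family C Q (pullback_height f \<rho>) r (pullback f M) (pullback f N) (\<lambda>x y. \<phi> (f x) (f y))"
  using order_preservingD(1) by (auto simp: shift_family_def pullback_def dest: down_pullback)

lemma inverse_shifts_pullback:
  "inverse_shifts C P \<rho> r M \<phi> \<psi> \<Longrightarrow>
    inverse_shifts C Q (pullback_height f \<rho>) r (pullback f M)
      (\<lambda>x y. \<phi> (f x) (f y)) (\<lambda>x y. \<psi> (f x) (f y))"
  by (auto simp: inverse_shifts_def pullback_def dest: down_pullback up_pullback)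

end

theorem proposition4p1:
  fixes C :: "('o, 'm) cat"
    and P Q :: "'u rel"
    and \<rho> :: "'u \<Rightarrow> 'u \<Rightarrow> ennreal"
    and f :: "'u \<Rightarrow> 'u"
    and M N :: "('u, 'o, 'm) pfunc"
  assumes "category C"
    and "complete_category TYPE('u) C"
    and "cocomplete_category TYPE('u) C"
    and "Partial_order P"
    and "Partial_order Q"
    and "height_difference P \<rho>"
    and "order_preserving Q P f"
    and "is_functor (poset_cat P) C M"
    and "is_functor (poset_cat P) C N"
  shows "interleaving_dist C Q (pullback_height f \<rho>) (pullback f M) (pullback f N)
      \<le> interleaving_dist C P \<rho> M N"
proof -
  note f = assms(7)
  \<comment> \<open>The distances are compared one \<open>r\<close> at a time: every interleaving
    parameter of M and N is one of their pullbacks.\<close>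
  have "height_interleaved C Q (pullback_height f \<rho>) r (pullback f M) (pullback f N)"
    if "height_interleaved C P \<rho> r M N" for r
  proof -
    interpret P: height_poset C P \<rho> r
      using assms by (simp add: height_poset_def height_poset_axioms_def)
    interpret Q: height_poset C Q "pullback_height f \<rho>" r
      using assms height_difference_pullback[OF f]
      by (simp add: height_poset_def height_poset_axioms_def)
    show ?thesis
      using that shift_family_pullback[OF f] inverse_shifts_pullback[OF f]
      unfolding P.height_interleaved_iff_shifts[OF assms(8,9)]
        Q.height_interleaved_iff_shifts[OF assms(8,9)[THEN is_functor_pullback[OF f]]]
      by meson
  qed
  \<comment> \<open>The infimum for the pullbacks runs over a larger set of parameters. If M and N
    admit none, their distance is the top element of \<open>ennreal\<close> and the bound is
    trivial.\<close>
  then show ?thesis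
    unfolding interleaving_dist_def by (intro INF_superset_mono) auto
qed

end
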